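(* Given the set of conserved variables $(\varrho,\varrho v,\varrho E)$ or $(\varrho,\varrho v,\varrho\theta)$, a numerical flux $(f^{\mathrm{num}}_\varrho,f^{\mathrm{num}}_{\varrho v},f^{\mathrm{num}}_{\varrho E})$ or $(f^{\mathrm{num}}_\varrho,f^{\mathrm{num}}_{\varrho v},f^{\mathrm{num}}_{\varrho\theta})$, respectively, a source term $S^{\varrho v}$ and the corresponding finite volume method with gravity are kinetic and potential energy preserving (KPEP) if (i) the density flux and the source term are of the form $f^{\mathrm{num}}_\varrho=\overline\varrho\,\{\!\{v\}\!\}$ and $S^{\varrho v}=\overline\varrho\,[\![\phi]\!]$ with the same mean value $\overline\varrho$; and (ii) the numerical flux is kinetic energy preserving (KEP), i.e. $f^{\mathrm{num}}_{\varrho v}=\{\!\{v\}\!\}f^{\mathrm{num}}_\varrho+\{\!\{p\}\!\}$.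
   Context: The mass and momentum equations are $\partial_t\varrho+\partial_x(\varrho v)=0$, $\partial_t(\varrho v)+\partial_x(\varrho v^2+p)=-\varrho\,\partial_x\phi$ with $\varrho>0$ and a time-independent geopotential $\phi=\phi(x)$; they are closed either by the equation $\partial_t(\varrho E)+\partial_x((\varrho E+p)v)=-\varrho v\,\partial_x\phi$ with $p=(\gamma-1)(\varrho E-\frac12\varrho v^2)$, or by $\partial_t(\varrho\theta)+\partial_x(\varrho\theta v)=0$ with $p=K(\varrho\theta)^\gamma$ (constants $K>0$, $\gamma>1$). At the interface $i+\frac12$ between cells $i$ and $i+1$: $[\![a]\!]_{i+1/2}=a_{i+1}-a_i$, $\{\!\{a\}\!\}_{i+1/2}=(a_{i+1}+a_i)/2$; $\overline\varrho_{i+1/2}$ is any consistent mean value of the density, i.e. a two-point function of the adjacent states with $\overline\varrho_{i+1/2}=\varrho$ whenever $\varrho_i=\varrho_{i+1}=\varrho$. The mass and momentum parts of the finite volume method are $$\partial_t\varrho_i=-\frac{f^\varrho_{i+1/2}-f^\varrho_{i-1/2}}{\Delta x},\qquad \partial_t(\varrho v)_i=-\frac{f^{\varrho v}_{i+1/2}-f^{\varrho v}_{i-1/2}}{\Delta x}-\frac{S^{\varrho v}_{i+1/2}+S^{\varrho v}_{i-1/2}}{2\Delta x},$$ with $f_{i+1/2}=f^{\mathrm{num}}(u_i,u_{i+1})$. At the continuous level, $\partial_t(\frac12\varrho v^2+\varrho\phi)=-\partial_x\big(v(\frac12\varrho v^2+p+\varrho\phi)\big)+p\,\partial_xv$. The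 method is KPEP if it mimics this: there is a two-point function $G_{i+1/2}$ of $(u_i,\phi_i)$ and $(u_{i+1},\phi_{i+1})$, consistent with $v(\frac12\varrho v^2+p+\varrho\phi)$, such that for all $i$ $$\partial_t\Big(\tfrac12\varrho_iv_i^2+\varrho_i\phi_i\Big)=-\frac{G_{i+1/2}-G_{i-1/2}}{\Delta x}+p_i\,\frac{v_{i+1}-v_{i-1}}{2\Delta x}.$$ *)

theory Defs
  imports Complex_Main
begin

(* One record serves both for the conserved variables and for the (numerical) flux vectors;
   the third component belongs to rho*E or to rho*theta, depending on the closure. *)
record cvec =
  dens  :: real
  mom   :: real
  third :: real

datatype closure =
    Energy real          (* gamma *)
  | PotTemp real real    (* K, gamma *)

fun valid_closure :: "closure \<Rightarrow> bool" where
  "valid_closure (Energy \<gamma>) \<longleftrightarrow> \<gamma> > 1"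
| "valid_closure (PotTemp K \<gamma>) \<longleftrightarrow> K > 0 \<and> \<gamma> > 1"

(* The real power (rho*theta) powr gamma is meaningful for rho*theta >= 0 only. *)
fun admissible :: "closure \<Rightarrow> cvec \<Rightarrow> bool" where
  "admissible (Energy \<gamma>) u \<longleftrightarrow> dens u > 0"
| "admissible (PotTemp K \<gamma>) u \<longleftrightarrow> dens u > 0 \<and> third u \<ge> 0"

definition vel :: "cvec \<Rightarrow> real" where
  "vel u = mom u / dens u"

fun pressure :: "closure \<Rightarrow> cvec \<Rightarrow> real" where
  "pressure (Energy \<gamma>) u = (\<gamma> - 1) * (third u - 1/2 * dens u * (vel u)^2)"
| "pressure (PotTemp K \<gamma>) u = K * (third u) powr \<gamma>"

definition jump :: "real \<Rightarrow> real \<Rightarrow> real" where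
  "jump a b = b - a"

definition avg :: "real \<Rightarrow> real \<Rightarrow> real" where
  "avg a b = (b + a) / 2"

type_synonym numflux = "cvec \<Rightarrow> cvec \<Rightarrow> cvec"

(* A two-point function of the states together with the geopotential values. *)
type_synonym two_point = "cvec \<times> real \<Rightarrow> cvec \<times> real \<Rightarrow> real"

definition density_mean :: "closure \<Rightarrow> (cvec \<Rightarrow> cvec \<Rightarrow> real) \<Rightarrow> bool" where
  "density_mean c rbar \<longleftrightarrow>
     (\<forall>a b. admissible c a \<longrightarrow> admissible c b \<longrightarrow> dens a = dens b \<longrightarrow> rbar a b = dens a)"

definition density_flux_form ::
    "closure \<Rightarrow> (cvec \<Rightarrow> cvec \<Rightarrow> real) \<Rightarrow> numflux \<Rightarrow> bool" where
  "density_flux_form c rbar F \<longleftrightarrow>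
     (\<forall>a b. admissible c a \<longrightarrow> admissible c b \<longrightarrow>
        dens (F a b) = rbar a b * avg (vel a) (vel b))"

definition source_form ::
    "closure \<Rightarrow> (cvec \<Rightarrow> cvec \<Rightarrow> real) \<Rightarrow> two_point \<Rightarrow> bool" where
  "source_form c rbar S \<longleftrightarrow>
     (\<forall>a b x y. admissible c a \<longrightarrow> admissible c b \<longrightarrow>
        S (a, x) (b, y) = rbar a b * jump x y)"

definition KEP :: "closure \<Rightarrow> numflux \<Rightarrow> bool" where
  "KEP c F \<longleftrightarrow>
     (\<forall>a b. admissible c a \<longrightarrow> admissible c b \<longrightarrow>
        mom (F a b) = avg (vel a) (vel b) * dens (F a b) + avg (pressure c a) (pressure c b))"

(* The mass and momentum parts of the semi-discrete method hold at time t, in all cells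
   i of an infinite grid (periodic grids are covered by periodic extension). Here u s i is
   the state of cell i at time s, T is the set of times under consideration, and the
   interface i + 1/2 lies between the cells i and i + 1. No equation is imposed on the
   third component, hence any discretization of it is covered. *)
definition fv_mass_momentum ::
    "numflux \<Rightarrow> two_point \<Rightarrow> real \<Rightarrow> (int \<Rightarrow> real) \<Rightarrow> real set \<Rightarrow> (real \<Rightarrow> int \<Rightarrow> cvec) \<Rightarrow> real \<Rightarrow> bool"
where
  "fv_mass_momentum F S dx \<phi> T u t \<longleftrightarrow>
     (\<forall>i.
       ((\<lambda>s. dens (u s i)) has_real_derivative
          - (dens (F (u t i) (u t (i+1))) - dens (F (u t (i-1)) (u t i))) / dx)
         (at t within T) \<and>
       ((\<lambda>s. mom (u s i)) has_real_derivative
          - (mom (F (u t i) (u t (i+1))) - mom (F (u t (i-1)) (u t i))) / dx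
          - (S (u t i, \<phi> i) (u t (i+1), \<phi> (i+1)) + S (u t (i-1), \<phi> (i-1)) (u t i, \<phi> i)) / (2 * dx))
         (at t within T))"

definition energy_flux_consistent :: "closure \<Rightarrow> two_point \<Rightarrow> bool" where
  "energy_flux_consistent c G \<longleftrightarrow>
     (\<forall>a x. admissible c a \<longrightarrow>
        G (a, x) (a, x) = vel a * (1/2 * dens a * (vel a)^2 + pressure c a + dens a * x))"

(* G may depend on the method only, not on the grid, the geopotential or the solution.
   The evolution equations are required only at the time t at which the balance is
   asserted; this covers solutions on an interval T, and the condition does not become
   vacuous when the initial value problem has no solution. *)
definition KPEP :: "closure \<Rightarrow> numflux \<Rightarrow> two_point \<Rightarrow> bool" where
  "KPEP c F S \<longleftrightarrow>
     (\<exists>G. energy_flux_consistent c G \<and>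
       (\<forall>dx \<phi> T u t.
          dx > 0 \<longrightarrow> t \<in> T \<longrightarrow> (\<forall>i. admissible c (u t i)) \<longrightarrow>
          fv_mass_momentum F S dx \<phi> T u t \<longrightarrow>
          (\<forall>i. ((\<lambda>s. 1/2 * dens (u s i) * (vel (u s i))^2 + dens (u s i) * \<phi> i)
                 has_real_derivative
                   - (G (u t i, \<phi> i) (u t (i+1), \<phi> (i+1))
                      - G (u t (i-1), \<phi> (i-1)) (u t i, \<phi> i)) / dx
                   + pressure c (u t i) * ((vel (u t (i+1)) - vel (u t (i-1))) / (2 * dx)))
                (at t within T))))"

end

theory Submission
  imports Defs
begin

text \<open>
  By the chain rule the energy density \<open>\<rho> v\<^sup>2 / 2 + \<rho> \<phi>\<close> of a cell changes at the rate
  \<open>v (\<rho> v)' + (\<phi> - v\<^sup>2 / 2) \<rho>'\<close>. After inserting the scheme, the contribution of each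
  interface telescopes in three separate groups. Write \<open>a\<close> and \<open>b\<close> for the two states at an
  interface and \<open>r\<close> for the mean density there. The advective part of the momentum flux gives
  the kinetic energy flux \<open>r avg(v) v\<^sub>a v\<^sub>b / 2\<close>, because \<open>v avg(v) - v\<^sup>2 / 2 = v\<^sub>a v\<^sub>b / 2\<close>
  whether \<open>v\<close> is \<open>v\<^sub>a\<close> or \<open>v\<^sub>b\<close>. The averaged pressure obeys a discrete product rule with flux
  \<open>(v\<^sub>a p\<^sub>b + v\<^sub>b p\<^sub>a) / 2\<close>, which leaves over precisely the term with \<open>p\<close> times the central
  difference of \<open>v\<close>. The potential energy carried by the density flux and the work of the source
  combine to \<open>r (v\<^sub>a \<phi>\<^sub>b + v\<^sub>b \<phi>\<^sub>a) / 2\<close>, and this is where the density flux and the source need the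
  same mean value. The sum of the three fluxes is consistent because \<open>r\<close> is.
\<close>

text \<open>
  The interface flux of kinetic and potential energy: kinetic energy, pressure work and potential
  energy, in this order. The geopotential values are the second components of the arguments.
\<close>
definition energy_flux :: "closure \<Rightarrow> (cvec \<Rightarrow> cvec \<Rightarrow> real) \<Rightarrow> two_point" where
  "energy_flux c rbar = (\<lambda>(a, x) (b, y).
     rbar a b * avg (vel a) (vel b) * (vel a * vel b / 2)
     + (vel a * pressure c b + vel b * pressure c a) / 2
     + rbar a b * (vel a * y + vel b * x) / 2)"

lemma admissible_dens_pos: "admissible c u \<Longrightarrow> dens u > 0"
  by (cases c) auto

lemma energy_flux_consistent_energy_flux:
  assumes "density_mean c rbar"
  shows "energy_flux_consistent c (energy_flux c rbar)"
  using assms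
  by (auto simp: energy_flux_consistent_def density_mean_def energy_flux_def avg_def
      algebra_simps power2_eq_square)

text \<open>
  Only the density at the time \<open>t\<close> itself has to be nonzero, since the quotient rule within a set
  is a statement about the base point.
\<close>
lemma has_real_derivative_energy:
  assumes "((\<lambda>s. dens (w s)) has_real_derivative r') (at t within T)"
    and "((\<lambda>s. mom (w s)) has_real_derivative m') (at t within T)"
    and "dens (w t) \<noteq> 0"
  shows "((\<lambda>s. 1/2 * dens (w s) * (vel (w s))^2 + dens (w s) * x) has_real_derivative
            vel (w t) * m' + (x - (vel (w t))^2 / 2) * r') (at t within T)"
  unfolding vel_def
  by (rule derivative_eq_intros assms refl)+
    (use assms(3) in \<open>simp add: field_simps power2_eq_square\<close>)

text \<open>
  The telescoping identity at one cell. The values \<open>vm\<close>, \<open>v\<close>, \<open>vp\<close> are the velocities of the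
  left, the central and the right cell, likewise for the pressures \<open>p\<close> and the geopotentials
  \<open>x\<close>; \<open>rm\<close> and \<open>rp\<close> are the mean densities at the left and the right interface.
\<close>
lemma cell_energy_balance:
  fixes v vm vp p pm pp x xm xp rm rp dx :: real
  shows "v * (- ((avg v vp * (rp * avg v vp) + avg p pp)
                 - (avg vm v * (rm * avg vm v) + avg pm p)) / dx
              - (rp * jump x xp + rm * jump xm x) / (2 * dx))
         + (x - v^2 / 2) * (- (rp * avg v vp - rm * avg vm v) / dx)
       = - ((rp * avg v vp * (v * vp / 2) + (v * pp + vp * p) / 2 + rp * (v * xp + vp * x) / 2)
            - (rm * avg vm v * (vm * v / 2) + (vm * p + v * pm) / 2 + rm * (vm * x + v * xm) / 2)) / dx
         + p * ((vp - vm) / (2 * dx))"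
proof (cases "dx = 0")
  case False
  then show ?thesis
    by (simp add: avg_def jump_def field_simps power2_eq_square)
qed simp

theorem lemma4p3:
  fixes c :: closure
    and F :: numflux
    and S :: two_point
    and rbar :: "cvec \<Rightarrow> cvec \<Rightarrow> real"
  assumes "valid_closure c"
    and "density_mean c rbar"
    and "density_flux_form c rbar F"
    and "source_form c rbar S"
    and "KEP c F"
  shows "KPEP c F S"
  unfolding KPEP_def
proof (intro exI[of _ "energy_flux c rbar"] conjI allI impI)
  show "energy_flux_consistent c (energy_flux c rbar)"
    using assms(2) by (rule energy_flux_consistent_energy_flux)
next
  fix dx :: real and \<phi> :: "int \<Rightarrow> real" and T :: "real set"
    and u :: "real \<Rightarrow> int \<Rightarrow> cvec" and t :: real and i :: int
  assume adm: "\<forall>i. admissible c (u t i)" and fv: "fv_mass_momentum F S dx \<phi> T u t"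
  have densF: "dens (F (u t j) (u t k)) = rbar (u t j) (u t k) * avg (vel (u t j)) (vel (u t k))"
    for j k using assms(3) adm by (simp add: density_flux_form_def)
  have momF: "mom (F (u t j) (u t k)) =
      avg (vel (u t j)) (vel (u t k)) * (rbar (u t j) (u t k) * avg (vel (u t j)) (vel (u t k)))
      + avg (pressure c (u t j)) (pressure c (u t k))" for j k
    using assms(5) adm densF by (simp add: KEP_def)
  have source: "S (u t j, x) (u t k, y) = rbar (u t j) (u t k) * jump x y" for j k x y
    using assms(4) adm by (simp add: source_form_def)
  have "dens (u t i) \<noteq> 0"
    using adm admissible_dens_pos by (metis less_irrefl)
  from has_real_derivative_energy[where w = "\<lambda>s. u s i" and x = "\<phi> i", OF
      fv[unfolded fv_mass_momentum_def, rule_format, THEN conjunct1, of i]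
      fv[unfolded fv_mass_momentum_def, rule_format, THEN conjunct2, of i] this]
  show "((\<lambda>s. 1/2 * dens (u s i) * (vel (u s i))^2 + dens (u s i) * \<phi> i) has_real_derivative
          - (energy_flux c rbar (u t i, \<phi> i) (u t (i+1), \<phi> (i+1))
             - energy_flux c rbar (u t (i-1), \<phi> (i-1)) (u t i, \<phi> i)) / dx
          + pressure c (u t i) * ((vel (u t (i+1)) - vel (u t (i-1))) / (2 * dx)))
        (at t within T)"
    unfolding densF momF source cell_energy_balance energy_flux_def by simp
qed

end
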